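(* Let $\mathcal{C}$ be a clutter with vertex set $X=\{x_1,\ldots,x_n\}$, let $I(\mathcal{C})\subset R=K[x_1,\ldots,x_n]$ be its edge ideal, where $K$ is a field, and let $0\neq a=(a_1,\ldots,a_n)\in\mathbb{N}^n$ and $b\in\mathbb{N}$. Then $x^at^b=x_1^{a_1}\cdots x_n^{a_n}t^b$ is a minimal generator of the symbolic Rees algebra $R_s(I(\mathcal{C}))$, as a $K$-algebra, if and only if $\mathcal{C}^a$ is an indecomposable clutter and $b=\alpha_0(\mathcal{C}^a)$.
   Context: $\mathbb{N}=\{0,1,2,\ldots\}$. A clutter $\mathcal{C}$ with finite nonempty vertex set $X=V(\mathcal{C})=\{x_1,\ldots,x_n\}$ is a family $E(\mathcal{C})$ of nonempty subsets of $X$, called edges, none of which is included in another (the family may be empty). Edge ideal: $R=K[x_1,\ldots,x_n]$ is a polynomial ring over a field $K$ (vertices are identified with variables), and $I=I(\mathcal{C})$ is the ideal of $R$ generated by the monomials $x_e=\prod_{x_i\in e}x_i$ with $e\in E(\mathcal{C})$ ($I=0$ if there are no edges). Symbolic powers: let $\mathfrak{p}_1,\ldots,\mathfrak{p}_s$ be the minimal primes of $I$ and $S=R\setminus\bigcup_{k=1}^s\mathfrak{p}_k$. For $i\ge 1$ the $i$th symbolic power of $I$ is $I^{(i)}=S^{-1}I^i\cap R$; for these ideals $I^{(i)}=\mathfrak{p}_1^i\cap\cdots\cap\mathfrak{p}_s^i$. The symbolic Rees algebra of $I$ is $R_s(I)=R\oplus I^{(1)}t\oplus I^{(2)}t^2\oplus\cdots\subset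 R[t]$, with $t$ a new variable. $R_s(I)$ is generated as a $K$-algebra by a unique minimal finite set of monomials in $x_1,\ldots,x_n,t$; the elements of that set are called the minimal generators of $R_s(I)$. Vertex covering number: a subset $C\subset V(\mathcal{C})$ is a vertex cover of $\mathcal{C}$ if every edge contains at least one vertex of $C$. $\alpha_0(\mathcal{C})$ is the minimum number of vertices in a vertex cover ($\alpha_0=0$ if there are no edges). Indecomposability: for $S\subset V(\mathcal{C})$, the induced subclutter $\mathcal{C}[S]$ has vertex set $S$ and as edges exactly the edges of $\mathcal{C}$ contained in $S$. $\mathcal{C}$ is decomposable if there are nonempty disjoint sets $X_1,X_2$ with $V(\mathcal{C})=X_1\cup X_2$ and $\alpha_0(\mathcal{C})=\alpha_0(\mathcal{C}[X_1])+\alpha_0(\mathcal{C}[X_2])$; otherwise it is indecomposable. Parallelization: duplicating a vertex $x_i$ means adding a new vertex $x_i'$ and replacing the edge set $E$ by $E\cup\{(e\setminus\{x_i\})\cup\{x_i'\} : x_i\in e\in E\}$. Deleting $x_i$ means removing $x_i$ and all edges containing it. For $a\in\mathbb{N}^n$, $\mathcal{C}^a$ is the clutter obtained from $\mathcal{C}$ by deleting every vertex $x_i$ with $a_i=0$ and duplicating $a_i-1$ times every vertex $x_i$ with $a_i\geq1$. Explicitly, $\mathcal{C}^a$ has vertices $x_i^j$ (where $j$ is an index) with $1\le i\le n$, $1\le j\le a_i$, and its edges are the sets $\{x_{k_1}^{j_1},\ldots,x_{k_r}^{j_r}\}$ with $\{x_{k_1},\ldots,x_{k_r}\}$ an edge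 of $\mathcal{C}$ (with $r$ distinct vertices) and $1\le j_i\le a_{k_i}$.
   Formalization: The formal theorem excludes the pairs where x^a t^b is a single variable x_i (b = 0) and {x_i} is an edge of the clutter; there x_i is a minimal generator but the covering number of C^a is 1, so the stated equivalence fails. *)

theory Defs
  imports
    "HOL-Library.Poly_Mapping"
    "HOL-Computational_Algebra.Polynomial"
begin

section \<open>Clutters\<close>

record 'a clutter =
  verts :: "'a set"
  edges :: "'a set set"

definition clutter :: "'a clutter \<Rightarrow> bool" where
  "clutter C \<longleftrightarrow> finite (verts C) \<and> verts C \<noteq> {} \<and>
     (\<forall>e\<in>edges C. e \<noteq> {} \<and> e \<subseteq> verts C) \<and>
     (\<forall>e\<in>edges C. \<forall>f\<in>edges C. e \<subseteq> f \<longrightarrow> e = f)"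

definition vertex_cover :: "'a clutter \<Rightarrow> 'a set \<Rightarrow> bool" where
  "vertex_cover C D \<longleftrightarrow> D \<subseteq> verts C \<and> (\<forall>e\<in>edges C. e \<inter> D \<noteq> {})"

definition covering_number :: "'a clutter \<Rightarrow> nat" (\<open>\<alpha>\<^sub>0\<close>) where
  "\<alpha>\<^sub>0 C = Min (card ` {D. vertex_cover C D})"

definition induced_subclutter :: "'a clutter \<Rightarrow> 'a set \<Rightarrow> 'a clutter" where
  "induced_subclutter C S = \<lparr>verts = S, edges = {e \<in> edges C. e \<subseteq> S}\<rparr>"

definition decomposable :: "'a clutter \<Rightarrow> bool" where
  "decomposable C \<longleftrightarrow> (\<exists>X1 X2. X1 \<noteq> {} \<and> X2 \<noteq> {} \<and> X1 \<inter> X2 = {} \<and> verts C = X1 \<union> X2 \<and>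
     \<alpha>\<^sub>0 C = \<alpha>\<^sub>0 (induced_subclutter C X1) + \<alpha>\<^sub>0 (induced_subclutter C X2))"

abbreviation indecomposable :: "'a clutter \<Rightarrow> bool" where
  "indecomposable C \<equiv> \<not> decomposable C"

text \<open>The pair \<open>(i, j)\<close> stands for the \<open>j\<close>-th copy of the vertex \<open>i\<close>. An edge of the
  parallelization picks one copy \<open>j k\<close> of each vertex \<open>k\<close> of an edge of \<open>C\<close>; vertices with
  \<open>a k = 0\<close> have no copy, so the edges through them disappear.\<close>

definition parallelization :: "'a clutter \<Rightarrow> ('a \<Rightarrow> nat) \<Rightarrow> ('a \<times> nat) clutter" where
  "parallelization C a =
     \<lparr>verts = {(i, j). i \<in> verts C \<and> 1 \<le> j \<and> j \<le> a i},
      edges = {(\<lambda>k. (k, j k)) ` e | e j. e \<in> edges C \<and> (\<forall>k\<in>e. 1 \<le> j k \<and> j k \<le> a k)}\<rparr>"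

lemma clutter_parallelization:
  assumes C: "clutter C" and a: "\<exists>i\<in>verts C. a i \<noteq> 0"
  shows "clutter (parallelization C a)"
  unfolding clutter_def
proof (intro conjI ballI impI)
  have "verts (parallelization C a) = Sigma (verts C) (\<lambda>i. {1..a i})"
    by (auto simp: parallelization_def)
  then show "finite (verts (parallelization C a))"
    using C by (auto simp: clutter_def)
  show "verts (parallelization C a) \<noteq> {}"
    using a by (force simp: parallelization_def)
next
  fix e assume "e \<in> edges (parallelization C a)"
  then show "e \<noteq> {}" "e \<subseteq> verts (parallelization C a)"
    using C by (fastforce simp: parallelization_def clutter_def)+
next
  fix e f assume "e \<in> edges (parallelization C a)" "f \<in> edges (parallelization C a)"
    and sub: "e \<subseteq> f"
  then obtain e' i f' j where e: "e = (\<lambda>k. (k, i k)) ` e'" "e' \<in> edges C"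
    and f: "f = (\<lambda>k. (k, j k)) ` f'" "f' \<in> edges C"
    by (auto simp: parallelization_def)
  have "e' \<subseteq> f'" using sub by (auto simp: e f)
  then have "e' = f'" using C e f by (auto simp: clutter_def)
  moreover have "i k = j k" if "k \<in> e'" for k using sub that by (auto simp: e f)
  ultimately show "e = f" by (auto simp: e f)
qed


section \<open>Ideals and symbolic powers\<close>

text \<open>Ideals of a commutative ring are its submodules as a module over itself.\<close>

lemma module_times: "module ((*) :: 'a::comm_ring_1 \<Rightarrow> 'a \<Rightarrow> 'a)"
  by unfold_locales (simp_all add: algebra_simps)

abbreviation is_ideal :: "'a::comm_ring_1 set \<Rightarrow> bool" where
  "is_ideal \<equiv> module.subspace (*)"

abbreviation ideal_gen :: "'a::comm_ring_1 set \<Rightarrow> 'a set" where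
  "ideal_gen \<equiv> module.span (*)"

primrec ideal_power :: "'a::comm_ring_1 set \<Rightarrow> nat \<Rightarrow> 'a set" where
  "ideal_power I 0 = UNIV"
| "ideal_power I (Suc n) = ideal_gen {f * g | f g. f \<in> I \<and> g \<in> ideal_power I n}"

definition is_prime_ideal :: "'a::comm_ring_1 set \<Rightarrow> bool" where
  "is_prime_ideal P \<longleftrightarrow> is_ideal P \<and> P \<noteq> UNIV \<and> (\<forall>f g. f * g \<in> P \<longrightarrow> f \<in> P \<or> g \<in> P)"

definition minimal_primes :: "'a::comm_ring_1 set \<Rightarrow> 'a set set" where
  "minimal_primes I = {P. is_prime_ideal P \<and> I \<subseteq> P \<and>
     (\<forall>Q. is_prime_ideal Q \<and> I \<subseteq> Q \<and> Q \<subseteq> P \<longrightarrow> Q = P)}"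

text \<open>\<open>S\<^sup>-\<^sup>1I\<^sup>n \<inter> R\<close> for \<open>S\<close> the complement of the union of the minimal primes of \<open>I\<close>: a ring
  element \<open>f\<close> is a fraction \<open>g / s\<close> with \<open>g \<in> I\<^sup>n\<close> and \<open>s \<in> S\<close> iff \<open>s * f \<in> I\<^sup>n\<close> for some
  \<open>s \<in> S\<close>. For \<open>n = 0\<close> this is the whole ring.\<close>

definition symbolic_power :: "'a::comm_ring_1 set \<Rightarrow> nat \<Rightarrow> 'a set" where
  "symbolic_power I n = {f. \<exists>s. s \<notin> \<Union> (minimal_primes I) \<and> s * f \<in> ideal_power I n}"

definition symbolic_rees :: "'a::comm_ring_1 set \<Rightarrow> 'a poly set" where
  "symbolic_rees I = {f. \<forall>i. coeff f i \<in> symbolic_power I i}"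


section \<open>Polynomial rings and edge ideals\<close>

text \<open>The polynomial ring over \<open>'k\<close> in the variables indexed by \<open>'v\<close>; a further univariate
  polynomial layer \<open>('v, 'k) mpoly poly\<close> adjoins the variable \<open>t\<close>.\<close>

type_synonym ('v, 'k) mpoly = "('v \<Rightarrow>\<^sub>0 nat) \<Rightarrow>\<^sub>0 'k"

definition Const :: "'k::comm_ring_1 \<Rightarrow> ('v, 'k) mpoly" where
  "Const c = Poly_Mapping.single 0 c"

definition Var :: "'v \<Rightarrow> ('v, 'k::comm_ring_1) mpoly" where
  "Var i = Poly_Mapping.single (Poly_Mapping.single i 1) 1"

definition edge_ideal :: "'v clutter \<Rightarrow> ('v, 'k::field) mpoly set" where
  "edge_ideal C = ideal_gen {\<Prod>i\<in>e. Var i | e. e \<in> edges C}"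

text \<open>The monomial \<open>x\<^sup>a t\<^sup>b\<close>.\<close>

definition xt_monom :: "('v::finite \<Rightarrow> nat) \<Rightarrow> nat \<Rightarrow> ('v, 'k::field) mpoly poly" where
  "xt_monom a b = monom (\<Prod>i\<in>UNIV. Var i ^ a i) b"

inductive_set K_algebra_gen :: "('v, 'k::field) mpoly poly set \<Rightarrow> ('v, 'k) mpoly poly set"
  for G where
  const: "[:Const c:] \<in> K_algebra_gen G"
| gen: "g \<in> G \<Longrightarrow> g \<in> K_algebra_gen G"
| add: "f \<in> K_algebra_gen G \<Longrightarrow> g \<in> K_algebra_gen G \<Longrightarrow> f + g \<in> K_algebra_gen G"
| mult: "f \<in> K_algebra_gen G \<Longrightarrow> g \<in> K_algebra_gen G \<Longrightarrow> f * g \<in> K_algebra_gen G"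

definition monomial_gens ::
    "('v::finite, 'k::field) mpoly poly set \<Rightarrow> ('v, 'k) mpoly poly set \<Rightarrow> bool" where
  "monomial_gens A G \<longleftrightarrow> finite G \<and> G \<subseteq> {xt_monom a b | a b. True} \<and> K_algebra_gen G = A"

text \<open>The description is meant for algebras \<open>A\<close>, such as symbolic Rees algebras of edge ideals,
  that have exactly one inclusion-minimal finite generating set of monomials.\<close>

definition minimal_generators ::
    "('v::finite, 'k::field) mpoly poly set \<Rightarrow> ('v, 'k) mpoly poly set" where
  "minimal_generators A =
     (THE G. monomial_gens A G \<and> (\<forall>H. H \<subset> G \<longrightarrow> \<not> monomial_gens A H))"

end

theory Submission
  imports Defs "HOL-Library.Product_Plus"
begin

text \<open>For an exponent \<open>a\<close> let \<open>w a\<close> be the least total weight of a vertex cover. The minimal primes of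
  the edge ideal are generated by the variables of the minimal vertex covers, and its \<open>b\<close>-th symbolic
  power is spanned by the monomials \<open>x\<^sup>a\<close> with \<open>b \<le> w a\<close>. Hence the symbolic Rees algebra is the monoid
  algebra of \<open>{(a, b). b \<le> w a}\<close>, and its minimal generators are the irreducible elements of this monoid,
  of which there are finitely many by Dickson's lemma. On the other side \<open>w a\<close> is the covering number of
  the parallelization, and a partition of its vertices amounts to a splitting \<open>a = a\<^sub>1 + a\<^sub>2\<close>. Since \<open>w\<close>
  is superadditive, \<open>(a, w a)\<close> splits in the monoid exactly if \<open>w a = w a\<^sub>1 + w a\<^sub>2\<close> for such a splitting.\<close>

interpretation ideal: module "(*) :: 'a::comm_ring_1 \<Rightarrow> 'a \<Rightarrow> 'a"
  by (rule module_times)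

abbreviation (input) lookup :: "('a \<Rightarrow>\<^sub>0 'b::zero) \<Rightarrow> 'a \<Rightarrow> 'b" where
  "lookup \<equiv> Poly_Mapping.lookup"

abbreviation (input) keys :: "('a \<Rightarrow>\<^sub>0 'b::zero) \<Rightarrow> 'a set" where
  "keys \<equiv> Poly_Mapping.keys"

section \<open>Products in the polynomial ring\<close>

text \<open>One coordinate of \<open>U\<close> after the other, only the elements with the least
  value there are kept in either set. If a pair of such elements has the same sum as another pair,
  that pair is minimal in both places too.\<close>

lemma unique_sum_pair_on:
  fixes A B :: "('v \<Rightarrow>\<^sub>0 nat) set"
  assumes "finite U" "A \<noteq> {}" "B \<noteq> {}"
  shows "\<exists>A' B'. A' \<subseteq> A \<and> B' \<subseteq> B \<and> A' \<noteq> {} \<and> B' \<noteq> {} \<and>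
    (\<forall>x\<in>A'. \<forall>x'\<in>A'. \<forall>i\<in>U. lookup x i = lookup x' i) \<and>
    (\<forall>y\<in>B'. \<forall>y'\<in>B'. \<forall>i\<in>U. lookup y i = lookup y' i) \<and>
    (\<forall>x\<in>A. \<forall>y\<in>B. \<forall>x'\<in>A'. \<forall>y'\<in>B'. x + y = x' + y' \<longrightarrow> x \<in> A' \<and> y \<in> B')"
  using assms
proof (induction U rule: finite_induct)
  case empty
  then show ?case by (intro exI[of _ A] exI[of _ B]) auto
next
  case (insert i U)
  obtain A' B' where sub: "A' \<subseteq> A" "B' \<subseteq> B" "A' \<noteq> {}" "B' \<noteq> {}"
    and cA: "\<forall>x\<in>A'. \<forall>x'\<in>A'. \<forall>i\<in>U. lookup x i = lookup x' i"
    and cB: "\<forall>y\<in>B'. \<forall>y'\<in>B'. \<forall>i\<in>U. lookup y i = lookup y' i"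
    and u: "\<forall>x\<in>A. \<forall>y\<in>B. \<forall>x'\<in>A'. \<forall>y'\<in>B'. x + y = x' + y' \<longrightarrow> x \<in> A' \<and> y \<in> B'"
    using insert.IH[OF insert.prems] by (elim exE conjE) (rule that)
  obtain \<alpha> where \<alpha>: "\<alpha> \<in> A'" "\<And>x. x \<in> A' \<Longrightarrow> lookup \<alpha> i \<le> lookup x i"
    using sub(3) ex_has_least_nat[of "\<lambda>x. x \<in> A'" _ "\<lambda>x. lookup x i"] by blast
  obtain \<beta> where \<beta>: "\<beta> \<in> B'" "\<And>x. x \<in> B' \<Longrightarrow> lookup \<beta> i \<le> lookup x i"
    using sub(4) ex_has_least_nat[of "\<lambda>x. x \<in> B'" _ "\<lambda>x. lookup x i"] by blast
  let ?A = "{x\<in>A'. lookup x i = lookup \<alpha> i}" and ?B = "{x\<in>B'. lookup x i = lookup \<beta> i}"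
  have "x \<in> ?A \<and> y \<in> ?B"
    if "x \<in> A" "y \<in> B" "x' \<in> ?A" "y' \<in> ?B" "x + y = x' + y'" for x y x' y'
  proof -
    have *: "x \<in> A'" "y \<in> B'" using u that by blast+
    have "lookup x i + lookup y i = lookup x' i + lookup y' i"
      using that(5) by (metis lookup_add)
    then show ?thesis using \<alpha>(2)[OF *(1)] \<beta>(2)[OF *(2)] that * by auto
  qed
  then have "\<forall>x\<in>A. \<forall>y\<in>B. \<forall>x'\<in>?A. \<forall>y'\<in>?B. x + y = x' + y' \<longrightarrow> x \<in> ?A \<and> y \<in> ?B"
    by blast
  moreover have "\<forall>x\<in>?A. \<forall>x'\<in>?A. \<forall>j\<in>insert i U. lookup x j = lookup x' j"
    using cA by auto
  moreover have "\<forall>x\<in>?B. \<forall>x'\<in>?B. \<forall>j\<in>insert i U. lookup x j = lookup x' j"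
    using cB by auto
  moreover have "?A \<subseteq> A" "?B \<subseteq> B" "?A \<noteq> {}" "?B \<noteq> {}"
    using sub \<alpha>(1) \<beta>(1) by auto
  ultimately show ?case by (intro exI[of _ ?A] exI[of _ ?B] conjI)
qed

text \<open>This replaces a monomial order, which is not available because the variables are unordered.\<close>

lemma unique_sum_pair:
  fixes A B :: "('v::finite \<Rightarrow>\<^sub>0 nat) set"
  assumes "A \<noteq> {}" "B \<noteq> {}"
  obtains \<alpha> \<beta> where "\<alpha> \<in> A" "\<beta> \<in> B"
    "\<And>x y. x \<in> A \<Longrightarrow> y \<in> B \<Longrightarrow> x + y = \<alpha> + \<beta> \<Longrightarrow> x = \<alpha> \<and> y = \<beta>"
proof -
  obtain A' B' where sub: "A' \<subseteq> A" "B' \<subseteq> B" "A' \<noteq> {}" "B' \<noteq> {}"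
    and cA: "\<forall>x\<in>A'. \<forall>x'\<in>A'. \<forall>i\<in>UNIV. lookup x i = lookup x' i"
    and cB: "\<forall>x\<in>B'. \<forall>x'\<in>B'. \<forall>i\<in>UNIV. lookup x i = lookup x' i"
    and u: "\<forall>x\<in>A. \<forall>y\<in>B. \<forall>x'\<in>A'. \<forall>y'\<in>B'. x + y = x' + y' \<longrightarrow> x \<in> A' \<and> y \<in> B'"
    using unique_sum_pair_on[OF finite[of "UNIV::'v set"] assms] by (elim exE conjE) (rule that)
  have eA: "x = x'" if "x \<in> A'" "x' \<in> A'" for x x'
    using cA that by (auto intro!: poly_mapping_eqI)
  have eB: "x = x'" if "x \<in> B'" "x' \<in> B'" for x x'
    using cB that by (auto intro!: poly_mapping_eqI)
  obtain \<alpha> \<beta> where ab: "\<alpha> \<in> A'" "\<beta> \<in> B'" using sub by blast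
  show thesis
  proof (rule that[of \<alpha> \<beta>])
    show "\<alpha> \<in> A" "\<beta> \<in> B" using ab sub by auto
    show "x = \<alpha> \<and> y = \<beta>" if "x \<in> A" "y \<in> B" "x + y = \<alpha> + \<beta>" for x y
      using u that ab eA[OF _ ab(1)] eB[OF _ ab(2)] by meson
  qed
qed

text \<open>With the terms at \<alpha> and \<beta> split off, no cross term reaches the exponent
  \<alpha> + \<beta>: for \<open>?a * g'\<close> by cancellation, for \<open>f' * g\<close> by the
  uniqueness assumption.\<close>

lemma lookup_mult_unique:
  fixes f g :: "'a::cancel_comm_monoid_add \<Rightarrow>\<^sub>0 'k::comm_ring_1"
  assumes u: "\<And>x y. x \<in> keys f \<Longrightarrow> y \<in> keys g \<Longrightarrow> x + y = \<alpha> + \<beta> \<Longrightarrow> x = \<alpha> \<and> y = \<beta>"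
  shows "lookup (f * g) (\<alpha> + \<beta>) = lookup f \<alpha> * lookup g \<beta>"
proof -
  define f' g' where "f' = f - Poly_Mapping.single \<alpha> (lookup f \<alpha>)"
    and "g' = g - Poly_Mapping.single \<beta> (lookup g \<beta>)"
  have kf: "keys f' = keys f - {\<alpha>}" and kg: "keys g' = keys g - {\<beta>}"
    by (auto simp: f'_def g'_def in_keys_iff lookup_minus lookup_single when_def split: if_splits)
  let ?a = "Poly_Mapping.single \<alpha> (lookup f \<alpha>)" and ?b = "Poly_Mapping.single \<beta> (lookup g \<beta>)"
  have "f * g = (?a + f') * (?b + g')" by (simp add: f'_def g'_def)
  also have "\<dots> = ?a * ?b + (?a * g' + f' * g)"
    by (simp add: algebra_simps g'_def)
  finally have eq: "f * g = ?a * ?b + (?a * g' + f' * g)" .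
  have "\<alpha> + \<beta> \<notin> keys (?a * g')"
    using keys_mult[of ?a g'] kg by (auto split: if_splits)
  moreover have "\<alpha> + \<beta> \<notin> keys (f' * g)"
  proof
    assume "\<alpha> + \<beta> \<in> keys (f' * g)"
    then obtain x y where "x \<in> keys f'" "y \<in> keys g" "\<alpha> + \<beta> = x + y"
      using keys_mult[of f' g] by blast
    then show False using kf u[of x y] by auto
  qed
  ultimately show ?thesis
    by (simp add: eq lookup_add mult_single in_keys_iff)
qed

section \<open>Monomials and their exponents\<close>

lemma prod_single:
  "(\<Prod>i\<in>S. Poly_Mapping.single (h i) (1::'k::comm_ring_1)) =
    Poly_Mapping.single (\<Sum>i\<in>S. h i :: 'a::cancel_comm_monoid_add) 1"
  by (induction S rule: infinite_finite_induct) (auto simp: mult_single)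

lemma Var_power: "Var i ^ n = Poly_Mapping.single (Poly_Mapping.single i n) (1::'k::comm_ring_1)"
  by (induction n) (simp_all add: Var_def mult_single flip: single_add)

lemma sum_single_lookup:
  fixes m :: "'v::finite \<Rightarrow>\<^sub>0 nat"
  shows "(\<Sum>i\<in>UNIV. Poly_Mapping.single i (lookup m i)) = m"
  by (intro poly_mapping_eqI) (simp add: lookup_sum lookup_single when_def)

lemma prod_Var_power:
  fixes m :: "'v::finite \<Rightarrow>\<^sub>0 nat"
  shows "(\<Prod>i\<in>UNIV. Var i ^ lookup m i) = Poly_Mapping.single m (1::'k::comm_ring_1)"
  by (simp add: Var_power prod_single sum_single_lookup)

definition indicator_exponent :: "'v::finite set \<Rightarrow> 'v \<Rightarrow>\<^sub>0 nat" where
  "indicator_exponent e = (\<Sum>i\<in>e. Poly_Mapping.single i 1)"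

lemma lookup_indicator_exponent: "lookup (indicator_exponent e) i = (if i \<in> e then 1 else 0)"
  by (simp add: indicator_exponent_def lookup_sum lookup_single when_def)

lemma prod_Var: "(\<Prod>i\<in>e. Var i) = Poly_Mapping.single (indicator_exponent e) (1::'k::comm_ring_1)"
  by (simp add: Var_def prod_single indicator_exponent_def)

lemma exponent_eq_add:
  fixes m n :: "'v \<Rightarrow>\<^sub>0 nat"
  assumes "\<And>i. lookup n i \<le> lookup m i"
  shows "m = n + (m - n)"
  using assms by (intro poly_mapping_eqI) (simp add: lookup_add lookup_minus)

lemma poly_mapping_eq_sum_single: "f = (\<Sum>m\<in>keys f. Poly_Mapping.single m (lookup f m))"
  by (intro poly_mapping_eqI)
    (auto simp: lookup_sum lookup_single when_def in_keys_iff)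

section \<open>Symbolic powers of edge ideals\<close>

text \<open>The \<open>b\<close>-th power of the ideal generated by the variables in
  \<open>D\<close>, encoded by the degree in these variables so that membership is checked term by
  term.\<close>

definition vars_power :: "'v::finite set \<Rightarrow> nat \<Rightarrow> ('v, 'k::field) mpoly set" where
  "vars_power D b = {f. \<forall>m\<in>keys f. b \<le> sum (lookup m) D}"

lemma is_ideal_vars_power: "is_ideal (vars_power D b)"
proof (rule ideal.subspaceI)
  show "x + y \<in> vars_power D b" if "x \<in> vars_power D b" "y \<in> vars_power D b"
    for x y :: "('a, 'b) mpoly"
    using that Poly_Mapping.keys_add[of x y] by (auto simp: vars_power_def)
  show "c * x \<in> vars_power D b" if "x \<in> vars_power D b" for c x :: "('a, 'b) mpoly"
    using that keys_mult[of c x]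
    by (fastforce simp: vars_power_def lookup_add sum.distrib)
qed (simp add: vars_power_def)

lemma mult_vars_power:
  assumes "f \<in> vars_power D b" "g \<in> vars_power D c"
  shows "f * g \<in> vars_power D (b + c)"
  using assms keys_mult[of f g]
  by (fastforce simp: vars_power_def lookup_add sum.distrib intro: add_mono)

text \<open>Multiplication by an \<open>s\<close> outside the prime cannot raise the least
  \<open>D\<close>-degree of \<open>f\<close>. The terms of \<open>D\<close>-degree 0 in
  \<open>s\<close> and of least \<open>D\<close>-degree in \<open>f\<close> form the sets
  \<open>A\<close> and \<open>B\<close>; \<open>unique_sum_pair\<close> yields a term of the product
  that cannot cancel.\<close>

lemma vars_power_primary:
  assumes sf: "s * f \<in> vars_power D b" and s: "s \<notin> vars_power D 1"
  shows "f \<in> vars_power D b"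
proof (rule ccontr)
  assume "f \<notin> vars_power D b"
  then obtain m0 where m0: "m0 \<in> keys f" "sum (lookup m0) D < b"
    by (auto simp: vars_power_def not_le)
  obtain m1 where m1: "m1 \<in> keys f" "\<And>m. m \<in> keys f \<Longrightarrow> sum (lookup m1) D \<le> sum (lookup m) D"
    using m0 ex_has_least_nat[of "\<lambda>m. m \<in> keys f" m0 "\<lambda>m. sum (lookup m) D"] by blast
  define A where "A = {m\<in>keys s. sum (lookup m) D = 0}"
  define B where "B = {m\<in>keys f. sum (lookup m) D = sum (lookup m1) D}"
  have "A \<noteq> {}"
    using s by (auto simp: A_def vars_power_def not_le)
  moreover have "B \<noteq> {}" using m1(1) by (auto simp: B_def)
  ultimately
  obtain \<alpha> \<beta> where ab: "\<alpha> \<in> A" "\<beta> \<in> B"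
    and u: "\<And>x y. x \<in> A \<Longrightarrow> y \<in> B \<Longrightarrow> x + y = \<alpha> + \<beta> \<Longrightarrow> x = \<alpha> \<and> y = \<beta>"
    by (metis unique_sum_pair)
  have "lookup (s * f) (\<alpha> + \<beta>) = lookup s \<alpha> * lookup f \<beta>"
  proof (rule lookup_mult_unique)
    fix x y assume xy: "x \<in> keys s" "y \<in> keys f" "x + y = \<alpha> + \<beta>"
    \<comment> \<open>Both degrees are bounded below by their minima, which add up to the same
      total, so \<open>x\<close> and \<open>y\<close> attain them.\<close>
    have "sum (lookup x) D + sum (lookup y) D = sum (lookup \<alpha>) D + sum (lookup \<beta>) D"
      using arg_cong[OF xy(3), of "\<lambda>m. sum (lookup m) D"] by (simp add: lookup_add sum.distrib)
    moreover have "sum (lookup m1) D \<le> sum (lookup y) D" using m1(2) xy(2) .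
    moreover have "sum (lookup \<alpha>) D = 0" "sum (lookup \<beta>) D = sum (lookup m1) D"
      using ab unfolding A_def B_def by blast+
    ultimately have "sum (lookup x) D = 0" "sum (lookup y) D = sum (lookup m1) D" by linarith+
    then have "x \<in> A" "y \<in> B" using xy unfolding A_def B_def by blast+
    then show "x = \<alpha> \<and> y = \<beta>" using u xy(3) by blast
  qed
  also have "\<dots> \<noteq> 0" using ab by (auto simp: A_def B_def in_keys_iff)
  finally have "b \<le> sum (lookup (\<alpha> + \<beta>)) D"
    using sf by (auto simp: vars_power_def in_keys_iff)
  also have "\<dots> = sum (lookup m1) D"
    using ab by (auto simp: A_def B_def lookup_add sum.distrib)
  also have "\<dots> < b" using m0 m1(2) le_less_trans by blast
  finally show False by simp
qed

lemma one_notin_vars_power: "1 \<notin> vars_power D (Suc b)"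
  by (auto simp: vars_power_def)

text \<open>Primality is the case \<open>b = 1\<close> of \<open>vars_power_primary\<close>.\<close>

lemma is_prime_ideal_vars_power: "is_prime_ideal (vars_power D 1)"
  unfolding is_prime_ideal_def
  using is_ideal_vars_power[of D 1] vars_power_primary[of _ _ D 1] one_notin_vars_power[of D 0]
  by auto

lemma Var_in_vars_power_iff: "Var i \<in> vars_power D 1 \<longleftrightarrow> i \<in> D"
  by (auto simp: Var_def vars_power_def lookup_single when_def sum.If_cases)

text \<open>Every term of an element of \<open>vars_power D 1\<close> is divisible by a variable
  from \<open>D\<close>. Inclusions between primes can therefore be tested on variables.\<close>

lemma vars_power_subset:
  assumes P: "is_ideal P" and D: "\<And>i. i \<in> D \<Longrightarrow> Var i \<in> P"
  shows "vars_power D 1 \<subseteq> P"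
proof
  fix f :: "('a, 'b) mpoly" assume f: "f \<in> vars_power D 1"
  have "Poly_Mapping.single m (lookup f m) \<in> P" if "m \<in> keys f" for m
  proof -
    have "1 \<le> sum (lookup m) D" using f that by (auto simp: vars_power_def)
    then obtain i where i: "i \<in> D" "lookup m i \<noteq> 0"
      by (metis not_one_le_zero sum.neutral)
    then have "m = Poly_Mapping.single i 1 + (m - Poly_Mapping.single i 1)"
      by (intro exponent_eq_add) (auto simp: lookup_single when_def)
    then have "Poly_Mapping.single m (lookup f m) =
        Poly_Mapping.single (m - Poly_Mapping.single i 1) (lookup f m) * Var i"
      by (simp add: Var_def mult_single add.commute)
    then show ?thesis using ideal.subspace_scale[OF P D[OF i(1)]] by simp
  qed
  then show "f \<in> P"
    by (subst poly_mapping_eq_sum_single) (intro ideal.subspace_sum[OF P])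
qed

lemma prime_ideal_prod:
  assumes "is_prime_ideal P" "finite S" "prod h S \<in> P"
  shows "\<exists>i\<in>S. h i \<in> P"
  using assms(2,3)
proof (induction S rule: finite_induct)
  case empty
  have "x \<in> P" for x
    using assms(1) empty ideal.subspace_scale[of P 1 x] by (auto simp: is_prime_ideal_def)
  then show ?case using assms(1) by (auto simp: is_prime_ideal_def)
next
  case (insert i S)
  then show ?case using assms(1) by (auto simp: is_prime_ideal_def)
qed

section \<open>Weighted vertex covers and minimal covers\<close>

definition cover_weight :: "'v clutter \<Rightarrow> ('v \<Rightarrow> nat) \<Rightarrow> nat" where
  "cover_weight C a = Min (sum a ` {D. vertex_cover C D})"

text \<open>The polynomial ring has a variable for every element of \<open>'v\<close>, so vertices
  and variables coincide exactly if the vertex set is the whole type.\<close>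

locale full_clutter =
  fixes C :: "'v::finite clutter"
  assumes clutter: "clutter C" and verts: "verts C = UNIV"
begin

lemma vertex_cover_iff: "vertex_cover C D \<longleftrightarrow> (\<forall>e\<in>edges C. e \<inter> D \<noteq> {})"
  by (simp add: vertex_cover_def verts)

lemma vertex_cover_UNIV: "vertex_cover C UNIV"
  using clutter by (auto simp: vertex_cover_iff clutter_def)

lemma le_cover_weight_iff: "b \<le> cover_weight C a \<longleftrightarrow> (\<forall>D. vertex_cover C D \<longrightarrow> b \<le> sum a D)"
  using vertex_cover_UNIV unfolding cover_weight_def by (subst Min_ge_iff) auto

lemma cover_weight_le: "vertex_cover C D \<Longrightarrow> cover_weight C a \<le> sum a D"
  using le_cover_weight_iff by blast

lemma cover_weight_attained: "\<exists>D. vertex_cover C D \<and> cover_weight C a = sum a D"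
proof -
  have "cover_weight C a \<in> sum a ` {D. vertex_cover C D}"
    unfolding cover_weight_def using vertex_cover_UNIV by (intro Min_in) auto
  then show ?thesis by auto
qed

definition minimal_cover :: "'v set \<Rightarrow> bool" where
  "minimal_cover D \<longleftrightarrow> vertex_cover C D \<and> (\<forall>D'. vertex_cover C D' \<longrightarrow> D' \<subseteq> D \<longrightarrow> D' = D)"

lemma minimal_cover_exists:
  assumes "vertex_cover C D"
  obtains D' where "D' \<subseteq> D" "minimal_cover D'"
proof -
  obtain D' where "D' \<subseteq> D \<and> vertex_cover C D'"
    and min: "\<And>D''. D'' \<subseteq> D \<and> vertex_cover C D'' \<Longrightarrow> card D' \<le> card D''"
    using assms ex_has_least_nat[of "\<lambda>D'. D' \<subseteq> D \<and> vertex_cover C D'" D card] by blast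
  moreover have "D'' = D'" if "D'' \<subseteq> D'" "vertex_cover C D''" for D''
    using that calculation min[of D''] by (intro card_seteq) auto
  ultimately show thesis using that by (auto simp: minimal_cover_def)
qed

text \<open>Weights are nonnegative, so passing to a smaller cover does not increase the sum.
  Testing only minimal covers ties the weight to the minimal primes.\<close>

lemma le_cover_weight_iff_minimal:
  "b \<le> cover_weight C a \<longleftrightarrow> (\<forall>D. minimal_cover D \<longrightarrow> b \<le> sum a D)"
proof
  assume R: "\<forall>D. minimal_cover D \<longrightarrow> b \<le> sum a D"
  show "b \<le> cover_weight C a" unfolding le_cover_weight_iff
  proof (intro allI impI)
    fix D assume "vertex_cover C D"
    then obtain D' where "D' \<subseteq> D" "minimal_cover D'" by (rule minimal_cover_exists)
    then show "b \<le> sum a D" using R by (meson finite le_trans sum_mono2 zero_le)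
  qed
qed (auto simp: le_cover_weight_iff minimal_cover_def)

text \<open>Without \<open>i\<close> some edge is left uncovered, and it meets \<open>D\<close> in
  \<open>i\<close> alone. Dividing by such an edge monomial lowers the \<open>D\<close>-degree by
  exactly one.\<close>

lemma minimal_cover_private_edge:
  assumes "minimal_cover D" "i \<in> D"
  obtains e where "e \<in> edges C" "e \<inter> D = {i}"
proof -
  have "\<not> vertex_cover C (D - {i})" using assms by (auto simp: minimal_cover_def)
  moreover have "vertex_cover C D" using assms by (auto simp: minimal_cover_def)
  ultimately show thesis using that unfolding vertex_cover_iff by blast
qed

section \<open>Minimal primes and symbolic powers of the edge ideal\<close>

lemma edge_ideal_subset:
  assumes "is_ideal P" "\<And>e. e \<in> edges C \<Longrightarrow> (\<Prod>i\<in>e. Var i) \<in> P"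
  shows "edge_ideal C \<subseteq> P"
  unfolding edge_ideal_def using assms by (intro ideal.span_minimal) auto

lemma edge_ideal_subset_vars_power:
  assumes "vertex_cover C D"
  shows "(edge_ideal C :: ('v, 'k::field) mpoly set) \<subseteq> vars_power D 1"
proof (rule edge_ideal_subset[OF is_ideal_vars_power])
  fix e assume "e \<in> edges C"
  then have "e \<inter> D \<noteq> {}" using assms by (auto simp: vertex_cover_iff)
  then show "(\<Prod>i\<in>e. Var i :: ('v, 'k) mpoly) \<in> vars_power D 1"
    by (auto simp: prod_Var vars_power_def lookup_indicator_exponent sum.If_cases Suc_le_eq card_gt_0_iff)
qed

lemma ideal_power_subset_vars_power:
  assumes "vertex_cover C D"
  shows "ideal_power (edge_ideal C :: ('v, 'k::field) mpoly set) b \<subseteq> vars_power D b"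
proof (induction b)
  case 0
  then show ?case by (auto simp: vars_power_def)
next
  case (Suc b)
  have "f * g \<in> vars_power D (Suc b)"
    if "f \<in> edge_ideal C" "g \<in> ideal_power (edge_ideal C) b" for f g :: "('v, 'k) mpoly"
    using mult_vars_power[of f D 1 g b] that Suc edge_ideal_subset_vars_power[OF assms] by auto
  then have "{f * g | f g. f \<in> edge_ideal C \<and> g \<in> ideal_power (edge_ideal C) b} \<subseteq>
      (vars_power D (Suc b) :: ('v, 'k) mpoly set)" by blast
  then show ?case unfolding ideal_power.simps
    by (rule ideal.span_minimal[OF _ is_ideal_vars_power])
qed

lemma vertex_cover_of_prime:
  assumes "is_prime_ideal P" "(edge_ideal C :: ('v, 'k::field) mpoly set) \<subseteq> P"
  shows "vertex_cover C {i. Var i \<in> P}"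
  unfolding vertex_cover_iff
proof
  fix e assume "e \<in> edges C"
  then have "(\<Prod>i\<in>e. Var i :: ('v, 'k) mpoly) \<in> edge_ideal C"
    unfolding edge_ideal_def by (intro ideal.span_base) auto
  then show "e \<inter> {i. Var i \<in> P} \<noteq> {}"
    using prime_ideal_prod[OF assms(1), of e Var] assms(2) by auto
qed

text \<open>Every prime over the edge ideal contains the variables of a minimal cover, hence the
  prime of that cover. The cover is recovered from its prime as the set of variables inside, so
  minimality of primes and of covers agree.\<close>

lemma minimal_primes_edge_ideal:
  "minimal_primes (edge_ideal C :: ('v, 'k::field) mpoly set) =
    (\<lambda>D. vars_power D 1) ` {D. minimal_cover D}" (is "?L = ?R")
proof
  show "?L \<subseteq> ?R"
  proof
    fix P assume "P \<in> ?L"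
    then have P: "is_prime_ideal P" "edge_ideal C \<subseteq> P"
      and min: "\<And>Q. is_prime_ideal Q \<Longrightarrow> edge_ideal C \<subseteq> Q \<Longrightarrow> Q \<subseteq> P \<Longrightarrow> Q = P"
      by (auto simp: minimal_primes_def)
    obtain D where D: "D \<subseteq> {i. Var i \<in> P}" "minimal_cover D"
      using vertex_cover_of_prime[OF P] by (rule minimal_cover_exists)
    have "vars_power D 1 \<subseteq> P"
      using D P(1) by (intro vars_power_subset) (auto simp: is_prime_ideal_def)
    then have "vars_power D 1 = P"
      using D by (intro min is_prime_ideal_vars_power edge_ideal_subset_vars_power)
        (auto simp: minimal_cover_def)
    then show "P \<in> ?R" using D by auto
  qed
  show "?R \<subseteq> ?L"
  proof clarify
    fix D assume D: "minimal_cover D"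
    have "Q = vars_power D 1"
      if Q: "is_prime_ideal Q" "edge_ideal C \<subseteq> Q" "Q \<subseteq> vars_power D 1"
      for Q :: "('v, 'k) mpoly set"
    proof -
      have "{i. Var i \<in> Q} \<subseteq> D" using Q(3) Var_in_vars_power_iff by blast
      then have "{i. Var i \<in> Q} = D"
        using vertex_cover_of_prime[OF Q(1,2)] D by (auto simp: minimal_cover_def)
      then have "vars_power D 1 \<subseteq> Q"
        using Q(1) by (intro vars_power_subset) (auto simp: is_prime_ideal_def)
      then show ?thesis using Q(3) by auto
    qed
    then show "vars_power D 1 \<in> ?L"
      using D is_prime_ideal_vars_power[of D] edge_ideal_subset_vars_power[of D]
      unfolding minimal_primes_def minimal_cover_def by blast
  qed
qed

text \<open>Induction on \<open>b\<close>: a positive \<open>D\<close>-degree provides some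
  \<open>i\<close> in \<open>D\<close> that occurs in \<open>m\<close>, and its private edge can be
  divided off. The other vertices of that edge lie outside \<open>D\<close>, where the exponents are
  large enough for all \<open>b\<close> rounds.\<close>

lemma single_in_ideal_power:
  assumes D: "minimal_cover D"
    and "b \<le> sum (lookup m) D" "\<And>j. j \<notin> D \<Longrightarrow> b \<le> lookup m j"
  shows "Poly_Mapping.single m c \<in> ideal_power (edge_ideal C :: ('v, 'k::field) mpoly set) b"
  using assms(2,3)
proof (induction b arbitrary: m)
  case (Suc b)
  then have "sum (lookup m) D \<noteq> 0" by linarith
  then obtain i where i: "i \<in> D" "lookup m i \<noteq> 0" by (meson sum.neutral)
  obtain e where e: "e \<in> edges C" "e \<inter> D = {i}"
    using D i(1) by (rule minimal_cover_private_edge)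
  define m' where "m' = m - indicator_exponent e"
  have "lookup (indicator_exponent e) j \<le> lookup m j" for j
  proof (cases "j \<in> D \<and> j \<in> e")
    case True
    then have "j = i" using e(2) by blast
    then show ?thesis using i(2) by (simp add: lookup_indicator_exponent)
  next
    case False
    then show ?thesis using Suc.prems(2)[of j] by (auto simp: lookup_indicator_exponent)
  qed
  then have m: "m = indicator_exponent e + m'"
    unfolding m'_def by (rule exponent_eq_add)
  have "sum (lookup (indicator_exponent e)) D = 1"
    using e(2) by (simp add: lookup_indicator_exponent sum.If_cases Int_commute)
  then have "b \<le> sum (lookup m') D"
    using Suc.prems(1) by (simp add: m lookup_add sum.distrib)
  moreover have "b \<le> lookup m' j" if "j \<notin> D" for j
    using Suc.prems(2)[OF that] by (auto simp: m'_def lookup_minus lookup_indicator_exponent)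
  ultimately have "Poly_Mapping.single m' c \<in> ideal_power (edge_ideal C) b" by (rule Suc.IH)
  moreover have "(\<Prod>i\<in>e. Var i :: ('v, 'k) mpoly) \<in> edge_ideal C"
    using e unfolding edge_ideal_def by (intro ideal.span_base) auto
  moreover have "Poly_Mapping.single m c = (\<Prod>i\<in>e. Var i) * Poly_Mapping.single m' c"
    by (simp add: prod_Var mult_single m)
  ultimately show ?case by (auto intro!: ideal.span_base)
qed simp

lemma is_ideal_ideal_power: "is_ideal (ideal_power I b)"
  by (cases b) (auto simp: ideal.subspace_UNIV)

text \<open>The sum below avoids all minimal primes: modulo the prime of a minimal cover \<open>D\<close>
  only the summand for \<open>D\<close> survives.\<close>

lemma symbolic_power_edge_ideal:
  "symbolic_power (edge_ideal C :: ('v, 'k::field) mpoly set) b =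
    {f. \<forall>m\<in>keys f. b \<le> cover_weight C (lookup m)}"
proof
  have "b \<le> cover_weight C (lookup m)"
    if s: "s \<notin> \<Union> (minimal_primes (edge_ideal C))" and sf: "s * f \<in> ideal_power (edge_ideal C) b"
      and m: "m \<in> keys f" for f s :: "('v, 'k) mpoly" and m
    unfolding le_cover_weight_iff_minimal
  proof (intro allI impI)
    fix D assume D: "minimal_cover D"
    \<comment> \<open>Since \<open>s\<close> lies outside the prime of \<open>D\<close>, it can be
      cancelled from \<open>s * f\<close> in the power of that prime.\<close>
    have "s \<notin> vars_power D 1" using s D unfolding minimal_primes_edge_ideal by blast
    moreover have "s * f \<in> vars_power D b"
      using sf D ideal_power_subset_vars_power[of D b] unfolding minimal_cover_def by blast
    ultimately have "f \<in> vars_power D b" by (rule vars_power_primary[rotated])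
    then show "b \<le> sum (lookup m) D" using m by (auto simp: vars_power_def)
  qed
  then show "symbolic_power (edge_ideal C :: ('v, 'k) mpoly set) b \<subseteq>
      {f. \<forall>m\<in>keys f. b \<le> cover_weight C (lookup m)}"
    unfolding symbolic_power_def by auto
next
  \<comment> \<open>The exponent \<open>b\<close> outside \<open>D\<close> is what
    \<open>single_in_ideal_power\<close> asks for, while the variables of \<open>D\<close> do not
    occur.\<close>
  define u :: "'v set \<Rightarrow> 'v \<Rightarrow>\<^sub>0 nat" where "u D = (\<Sum>j\<in>-D. Poly_Mapping.single j b)" for D
  have lu: "lookup (u D) j = (if j \<in> D then 0 else b)" for D j
    by (simp add: u_def lookup_sum lookup_single when_def)
  define s :: "('v, 'k) mpoly" where
    "s = (\<Sum>D\<in>{D. minimal_cover D}. Poly_Mapping.single (u D) 1)"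
  show "{f. \<forall>m\<in>keys f. b \<le> cover_weight C (lookup m)} \<subseteq>
      symbolic_power (edge_ideal C :: ('v, 'k) mpoly set) b"
  proof clarify
    fix f :: "('v, 'k) mpoly" assume f: "\<forall>m\<in>keys f. b \<le> cover_weight C (lookup m)"
    show "f \<in> symbolic_power (edge_ideal C) b"
    \<comment> \<open>For \<open>b = 0\<close> all \<open>u D\<close> vanish and \<open>s\<close> is
      the number of minimal covers, which may be zero in the field; 1 takes its place.\<close>
    proof (cases "b = 0")
      case True
      have "1 \<notin> \<Union> (minimal_primes (edge_ideal C :: ('v, 'k) mpoly set))"
        using one_notin_vars_power[of _ 0] unfolding minimal_primes_edge_ideal by auto
      then show ?thesis using True unfolding symbolic_power_def by auto
    next
      case False
      have "s \<notin> vars_power D 1" if D: "minimal_cover D" for D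
      proof
        assume s: "s \<in> vars_power D 1"
        have fin: "finite {D. minimal_cover D}" by simp
        have "(\<Sum>D'\<in>{D. minimal_cover D} - {D}. Poly_Mapping.single (u D') 1 :: ('v, 'k) mpoly)
            \<in> vars_power D 1"
        proof (rule ideal.subspace_sum[OF is_ideal_vars_power])
          fix D' assume "D' \<in> {D. minimal_cover D} - {D}"
          \<comment> \<open>Distinct minimal covers are incomparable. As \<open>b\<close> is
            positive, the monomial of \<open>D'\<close> contains a variable of \<open>D\<close> and
            lies in its prime.\<close>
          then have "\<not> D \<subseteq> D'" using D by (auto simp: minimal_cover_def)
          then obtain j where j: "j \<in> D" "j \<notin> D'" by auto
          then have "lookup (u D') j \<le> sum (lookup (u D')) D" by (intro member_le_sum) auto
          then show "(Poly_Mapping.single (u D') 1 :: ('v, 'k) mpoly) \<in> vars_power D 1"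
            using j False by (auto simp: vars_power_def lu)
        qed
        moreover have "s = Poly_Mapping.single (u D) 1 +
            (\<Sum>D'\<in>{D. minimal_cover D} - {D}. Poly_Mapping.single (u D') 1)"
          unfolding s_def using D by (intro sum.remove[OF fin]) auto
        ultimately have "(Poly_Mapping.single (u D) 1 :: ('v, 'k) mpoly) \<in> vars_power D 1"
          using s ideal.subspace_diff[OF is_ideal_vars_power, of s D 1] by fastforce
        then show False by (auto simp: vars_power_def lu)
      qed
      then have "s \<notin> \<Union> (minimal_primes (edge_ideal C))"
        unfolding minimal_primes_edge_ideal by blast
      moreover have "s * f \<in> ideal_power (edge_ideal C) b"
      proof -
        have "Poly_Mapping.single (u D) 1 * Poly_Mapping.single m (lookup f m)
            \<in> ideal_power (edge_ideal C) b" if "minimal_cover D" "m \<in> keys f" for D m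
        proof -
          have "b \<le> sum (lookup m) D" using f that le_cover_weight_iff_minimal by blast
          then have "b \<le> sum (lookup (u D + m)) D"
            by (simp add: lookup_add sum.distrib trans_le_add2)
          moreover have "b \<le> lookup (u D + m) j" if "j \<notin> D" for j
            using that by (simp add: lookup_add lu)
          ultimately show ?thesis
            unfolding mult_single by (rule single_in_ideal_power[OF that(1)])
        qed
        then have "(\<Sum>D\<in>{D. minimal_cover D}. \<Sum>m\<in>keys f. Poly_Mapping.single (u D) 1 *
            Poly_Mapping.single m (lookup f m)) \<in> ideal_power (edge_ideal C) b"
          by (intro ideal.subspace_sum[OF is_ideal_ideal_power]) auto
        also have "(\<Sum>D\<in>{D. minimal_cover D}. \<Sum>m\<in>keys f. Poly_Mapping.single (u D) 1 *
            Poly_Mapping.single m (lookup f m)) = s * f"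
          unfolding s_def sum_product[symmetric]
          by (rule arg_cong[where f = "(*) _"]) (rule poly_mapping_eq_sum_single[symmetric])
        finally show ?thesis .
      qed
      ultimately show ?thesis unfolding symbolic_power_def by blast
    qed
  qed
qed

end


section \<open>Algebras spanned by monomials\<close>

inductive_set add_closure :: "'a::monoid_add set \<Rightarrow> 'a set" for B where
  zero: "0 \<in> add_closure B"
| base: "p \<in> B \<Longrightarrow> p \<in> add_closure B"
| add: "p \<in> add_closure B \<Longrightarrow> q \<in> add_closure B \<Longrightarrow> p + q \<in> add_closure B"

definition add_atoms :: "'a::monoid_add set \<Rightarrow> 'a set" where
  "add_atoms M = {p \<in> M. p \<noteq> 0 \<and> (\<forall>q\<in>M. \<forall>r\<in>M. p = q + r \<longrightarrow> q = 0 \<or> r = 0)}"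

text \<open>If a sum is an atom, one summand is zero and the other is the atom itself, so the
  induction ends in \<open>B\<close>.\<close>

lemma add_atoms_subset_generators:
  assumes "add_closure B = M"
  shows "add_atoms M \<subseteq> B"
proof
  fix p assume p: "p \<in> add_atoms M"
  then have "p \<in> add_closure B" by (auto simp: add_atoms_def assms)
  then show "p \<in> B" using p
  proof (induction p rule: add_closure.induct)
    case (add p q)
    then have "p = 0 \<or> q = 0" by (auto simp: add_atoms_def assms)
    then show ?case using add by auto
  qed (auto simp: add_atoms_def)
qed

text \<open>Indexing by pairs of exponents turns products of monomials into sums in one additive
  monoid.\<close>

definition xt :: "('v \<Rightarrow>\<^sub>0 nat) \<times> nat \<Rightarrow> ('v, 'k::field) mpoly poly" where
  "xt p = monom (Poly_Mapping.single (fst p) 1) (snd p)"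

lemma xt_monom_lookup: "xt_monom (lookup m) b = xt (m, b)"
  by (simp add: xt_monom_def xt_def prod_Var_power)

lemma xt_monom_eq_xt:
  fixes a :: "'v::finite \<Rightarrow> nat"
  shows "xt_monom a b = xt (Abs_poly_mapping a, b)"
  using xt_monom_lookup[of "Abs_poly_mapping a" b] by simp

lemma range_xt_monom:
  "{xt_monom a b | a b. True} = range (xt :: _ \<Rightarrow> ('v::finite, 'k::field) mpoly poly)"
proof
  show "{xt_monom a b | a b. True} \<subseteq> range (xt :: _ \<Rightarrow> ('v, 'k) mpoly poly)"
    using xt_monom_eq_xt by blast
  show "range (xt :: _ \<Rightarrow> ('v, 'k) mpoly poly) \<subseteq> {xt_monom a b | a b. True}"
    using xt_monom_lookup[symmetric] by auto
qed

lemma xt_0: "xt 0 = 1"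
  by (simp add: xt_def)

lemma xt_add: "xt (p + q) = xt p * xt q"
  by (simp add: xt_def mult_monom mult_single)

lemma inj_xt: "inj xt"
proof (rule injI)
  fix p q :: "('v \<Rightarrow>\<^sub>0 nat) \<times> nat" assume eq: "xt p = (xt q :: ('v, 'k::field) mpoly poly)"
  have "coeff (xt p) (snd p) = (coeff (xt q) (snd p) :: ('v, 'k) mpoly)" using eq by simp
  then have "keys (Poly_Mapping.single (fst p) (1::'k)) =
      keys (if snd q = snd p then Poly_Mapping.single (fst q) (1::'k) else 0)"
    by (simp add: xt_def)
  then show "p = q" by (auto simp: prod_eq_iff split: if_splits)
qed

text \<open>The \<open>K\<close>-span of the monomials with exponents in \<open>M\<close>, described
  by supports; for a submonoid \<open>M\<close> it is the monoid algebra.\<close>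

definition monomial_span ::
    "(('v \<Rightarrow>\<^sub>0 nat) \<times> nat) set \<Rightarrow> ('v, 'k::field) mpoly poly set" where
  "monomial_span M = {f. \<forall>i. \<forall>m\<in>keys (coeff f i). (m, i) \<in> M}"

lemma xt_in_monomial_span_iff: "xt p \<in> monomial_span M \<longleftrightarrow> p \<in> M"
  by (cases p) (auto simp: monomial_span_def xt_def)

lemma keys_sum_subset: "keys (sum h S) \<subseteq> (\<Union>i\<in>S. keys (h i))"
proof (induction S rule: infinite_finite_induct)
  case (insert i S)
  then show ?case using Poly_Mapping.keys_add[of "h i" "sum h S"] by auto
qed auto

lemma K_algebra_gen_sum:
  assumes "\<And>i. i \<in> S \<Longrightarrow> h i \<in> K_algebra_gen G"
  shows "sum h S \<in> K_algebra_gen G"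
  using assms
proof (induction S rule: infinite_finite_induct)
  case (infinite S)
  then show ?case using K_algebra_gen.const[of 0 G] by (simp add: Const_def)
next
  case empty
  then show ?case using K_algebra_gen.const[of 0 G] by (simp add: Const_def)
qed (auto intro: K_algebra_gen.add)

text \<open>The exponents of sums and products stay in the closure. Conversely, each polynomial is a
  finite sum of constants times monomials, and a monomial with exponent in the closure is a product
  of generators.\<close>

lemma K_algebra_gen_xt:
  "K_algebra_gen (xt ` B) = (monomial_span (add_closure B) :: ('v::finite, 'k::field) mpoly poly set)"
proof
  show "K_algebra_gen (xt ` B) \<subseteq> (monomial_span (add_closure B) :: ('v, 'k) mpoly poly set)"
  proof
    fix f :: "('v, 'k) mpoly poly" assume "f \<in> K_algebra_gen (xt ` B)"
    then show "f \<in> monomial_span (add_closure B)"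
    proof induction
      case (const c)
      show ?case using add_closure.zero[of B]
        by (auto simp: monomial_span_def Const_def zero_prod_def coeff_pCons split: nat.splits if_splits)
    next
      case (gen g)
      then show ?case by (auto simp: xt_in_monomial_span_iff intro: add_closure.base)
    next
      case (add f g)
      then show ?case using Poly_Mapping.keys_add
        unfolding monomial_span_def by (fastforce simp: subset_iff)
    next
      case (mult f g)
      have "(m, i) \<in> add_closure B" if m: "m \<in> keys (coeff (f * g) i)" for m i
      proof -
        obtain j where j: "j \<le> i" "m \<in> keys (coeff f j * coeff g (i - j))"
          using m keys_sum_subset[of "\<lambda>j. coeff f j * coeff g (i - j)" "{..i}"]
          by (auto simp: coeff_mult)
        then obtain x y where xy: "x \<in> keys (coeff f j)" "y \<in> keys (coeff g (i - j))" "m = x + y"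
          using keys_mult by blast
        then have "(x, j) \<in> add_closure B" "(y, i - j) \<in> add_closure B"
          using mult by (auto simp: monomial_span_def)
        from add_closure.add[OF this] show ?thesis using j xy by simp
      qed
      then show ?case by (auto simp: monomial_span_def)
    qed
  qed
next
  have xt: "xt p \<in> K_algebra_gen (xt ` B :: ('v, 'k) mpoly poly set)" if "p \<in> add_closure B" for p
    using that
  proof induction
    case zero
    then show ?case using K_algebra_gen.const[of 1 "xt ` B"]
      by (simp add: xt_0 Const_def one_pCons)
  qed (auto simp: xt_add intro: K_algebra_gen.gen K_algebra_gen.mult)
  show "(monomial_span (add_closure B) :: ('v, 'k) mpoly poly set) \<subseteq> K_algebra_gen (xt ` B)"
  proof
    fix f :: "('v, 'k) mpoly poly" assume f: "f \<in> monomial_span (add_closure B)"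
    have "[:Const (lookup (coeff f i) m):] * xt (m, i) \<in> K_algebra_gen (xt ` B)"
      if "m \<in> keys (coeff f i)" for i m
      using f that by (intro K_algebra_gen.mult K_algebra_gen.const xt) (auto simp: monomial_span_def)
    then have *: "(\<Sum>i\<le>degree f. \<Sum>m\<in>keys (coeff f i).
        [:Const (lookup (coeff f i) m):] * xt (m, i)) \<in> K_algebra_gen (xt ` B)"
      by (intro K_algebra_gen_sum)
    have "monom (coeff f i) i =
        (\<Sum>m\<in>keys (coeff f i). [:Const (lookup (coeff f i) m):] * xt (m, i))" for i
    proof -
      have "[:Const c:] * xt (m, i) = monom (Poly_Mapping.single m c) i" for c :: 'k and m :: "'v \<Rightarrow>\<^sub>0 nat"
        by (simp add: xt_def Const_def smult_monom mult_single)
      then show ?thesis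
        by (simp only: monom_sum[symmetric] poly_mapping_eq_sum_single[symmetric])
    qed
    then have "(\<Sum>i\<le>degree f. \<Sum>m\<in>keys (coeff f i).
        [:Const (lookup (coeff f i) m):] * xt (m, i)) = f"
      using poly_as_sum_of_monoms[of f] by simp
    then show "f \<in> K_algebra_gen (xt ` B)" using * by simp
  qed
qed

text \<open>Every finite monomial generating set contains the monomials of the atoms, and these
  generate. They form the least such set, so the definite description in
  \<open>minimal_generators\<close> has a unique solution.\<close>

lemma minimal_generators_monomial_span:
  fixes M :: "(('v::finite \<Rightarrow>\<^sub>0 nat) \<times> nat) set"
  assumes fin: "finite (add_atoms M)" and gen: "add_closure (add_atoms M) = M"
  shows "minimal_generators (monomial_span M) = (xt ` add_atoms M :: ('v, 'k::field) mpoly poly set)"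
proof -
  let ?A = "monomial_span M :: ('v, 'k) mpoly poly set"
  have atoms: "monomial_gens ?A (xt ` add_atoms M)"
    using fin gen unfolding monomial_gens_def range_xt_monom K_algebra_gen_xt by auto
  have least: "xt ` add_atoms M \<subseteq> G" if "monomial_gens ?A G" for G
  proof -
    have "G \<subseteq> range xt" using that unfolding monomial_gens_def range_xt_monom by blast
    then obtain B where B: "G = xt ` B" by (auto simp: subset_image_iff)
    then have eq: "(monomial_span (add_closure B) :: ('v, 'k) mpoly poly set) = ?A"
      using that by (simp add: monomial_gens_def K_algebra_gen_xt)
    have "add_closure B = M"
    proof (rule set_eqI)
      show "p \<in> add_closure B \<longleftrightarrow> p \<in> M" for p
        using arg_cong[OF eq, of "\<lambda>A. xt p \<in> A"] by (simp add: xt_in_monomial_span_iff)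
    qed
    then show ?thesis using add_atoms_subset_generators B by blast
  qed
  show ?thesis unfolding minimal_generators_def
  proof (rule the_equality)
    show "monomial_gens ?A (xt ` add_atoms M) \<and>
        (\<forall>H. H \<subset> xt ` add_atoms M \<longrightarrow> \<not> monomial_gens ?A H)"
      using atoms least by blast
    show "G = xt ` add_atoms M" if "monomial_gens ?A G \<and> (\<forall>H. H \<subset> G \<longrightarrow> \<not> monomial_gens ?A H)" for G
      using that atoms least[of G] by blast
  qed
qed

section \<open>Dickson's lemma\<close>

text \<open>A nonincreasing sequence of naturals is constant from the point where its minimum is
  attained, so in the decreasing case a shift by this index makes the subsequence monotone in the
  required sense.\<close>

lemma nat_seq_mono_subseq:
  fixes g :: "nat \<Rightarrow> nat"
  obtains r :: "nat \<Rightarrow> nat" where "strict_mono r" "mono (\<lambda>n. g (r n))"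
proof -
  obtain r where r: "strict_mono (r :: nat \<Rightarrow> nat)" and mon: "monoseq (\<lambda>n. g (r n))"
    using seq_monosub[of g] by blast
  show thesis
  proof (cases "\<forall>m. \<forall>n\<ge>m. g (r m) \<le> g (r n)")
    case True
    then show thesis using r that[of r] by (auto simp: mono_def)
  next
    case False
    then have dec: "\<And>m n. m \<le> n \<Longrightarrow> g (r n) \<le> g (r m)" using mon by (auto simp: monoseq_def)
    obtain k where k: "\<And>n. g (r k) \<le> g (r n)"
      using ex_has_least_nat[of "\<lambda>_. True" 0 "\<lambda>n. g (r n)"] by blast
    have "g (r (n + k)) = g (r k)" for n using dec[of k "n + k"] k[of "n + k"] by simp
    then have "mono (\<lambda>n. g (r (n + k)))" by (simp add: mono_def)
    moreover have "strict_mono (\<lambda>n. r (n + k))" using r by (simp add: strict_mono_def)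
    ultimately show thesis using that by blast
  qed
qed

text \<open>The functions are treated one at a time; thinning out further preserves the monotonicity
  already achieved.\<close>

lemma mono_subseq_finite_family:
  fixes f :: "nat \<Rightarrow> 'a" and F :: "('a \<Rightarrow> nat) set"
  assumes "finite F"
  shows "\<exists>r :: nat \<Rightarrow> nat. strict_mono r \<and> (\<forall>\<phi>\<in>F. mono (\<lambda>n. \<phi> (f (r n))))"
  using assms
proof (induction F rule: finite_induct)
  case empty
  then show ?case by (intro exI[of _ id]) (auto simp: strict_mono_def)
next
  case (insert \<phi> F)
  then obtain r :: "nat \<Rightarrow> nat"
    where r: "strict_mono r" "\<forall>\<phi>\<in>F. mono (\<lambda>n. \<phi> (f (r n)))" by blast
  obtain r' :: "nat \<Rightarrow> nat" where r': "strict_mono r'" "mono (\<lambda>n. \<phi> (f (r (r' n))))"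
    by (rule nat_seq_mono_subseq[of "\<lambda>n. \<phi> (f (r n))"])
  have "strict_mono (\<lambda>n. r (r' n))" using r(1) r'(1) by (simp add: strict_mono_def)
  moreover have "mono (\<lambda>n. \<psi> (f (r (r' n))))" if "\<psi> \<in> F" for \<psi>
    using monoD[OF bspec[OF r(2) that] monoD[OF strict_mono_mono[OF r'(1)]]] by (rule monoI)
  ultimately show ?case using r'(2) by (intro exI[of _ "\<lambda>n. r (r' n)"]) auto
qed

text \<open>Arbitrary functions into the naturals are allowed instead of coordinates only, so that
  further quantities can be compared along with the exponents. The first two members of a common
  monotone subsequence form the required pair.\<close>

lemma dickson:
  fixes F :: "('a \<Rightarrow> nat) set"
  assumes "finite F" "infinite S"
  obtains x y where "x \<in> S" "y \<in> S" "x \<noteq> y" "\<forall>\<phi>\<in>F. \<phi> x \<le> \<phi> y"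
proof -
  obtain f :: "nat \<Rightarrow> 'a" where f: "inj f" "range f \<subseteq> S"
    using assms(2) infinite_countable_subset by blast
  obtain r :: "nat \<Rightarrow> nat" where r: "strict_mono r" "\<forall>\<phi>\<in>F. mono (\<lambda>n. \<phi> (f (r n)))"
    using mono_subseq_finite_family[OF assms(1)] by blast
  have "r 0 < r 1" using r(1) by (simp add: strict_mono_def)
  then have "f (r 0) \<noteq> f (r 1)" using f(1) by (metis injD less_irrefl)
  then show thesis using f(2) r(2) that[of "f (r 0)" "f (r 1)"] by (auto simp: mono_def)
qed

section \<open>Exponents of the symbolic Rees algebra\<close>

context full_clutter
begin

definition rees_exponents :: "(('v \<Rightarrow>\<^sub>0 nat) \<times> nat) set" where
  "rees_exponents = {(m, b). b \<le> cover_weight C (lookup m)}"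

lemma symbolic_rees_edge_ideal:
  "symbolic_rees (edge_ideal C :: ('v, 'k::field) mpoly set) = monomial_span rees_exponents"
  by (simp add: symbolic_rees_def symbolic_power_edge_ideal monomial_span_def rees_exponents_def)

text \<open>For each fixed cover the weight is additive in the exponent, and a minimum of sums is at
  least the sum of the minima.\<close>

lemma cover_weight_superadditive:
  "cover_weight C a1 + cover_weight C a2 \<le> cover_weight C (\<lambda>i. a1 i + a2 i)"
  unfolding le_cover_weight_iff
  by (auto simp: sum.distrib intro!: add_mono cover_weight_le)

lemma cover_weight_zero: "cover_weight C (\<lambda>_. 0) = 0"
  using cover_weight_le[OF vertex_cover_UNIV, of "\<lambda>_. 0"] by simp

lemma lookup_add_fun: "lookup (m + n) = (\<lambda>i. lookup m i + lookup n i)"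
  by (simp add: fun_eq_iff lookup_add)

lemma rees_exponents_add: "p \<in> rees_exponents \<Longrightarrow> q \<in> rees_exponents \<Longrightarrow> p + q \<in> rees_exponents"
  using cover_weight_superadditive[of "lookup (fst p)" "lookup (fst q)"]
  by (auto simp: rees_exponents_def lookup_add_fun)

text \<open>No positive power of \<open>t\<close> alone lies in the algebra, so nonzero exponents
  have positive total degree in the vertex variables.\<close>

lemma rees_exponents_fst_zero: "(0, b) \<in> rees_exponents \<Longrightarrow> b = 0"
  using cover_weight_zero by (simp add: rees_exponents_def zero_poly_mapping.rep_eq)

lemma zero_in_rees_exponents: "0 \<in> rees_exponents"
  by (simp add: rees_exponents_def zero_prod_def)

text \<open>Dickson's lemma applies to the coordinates together with the slacks of the defining
  inequalities: if they are all dominated, the difference of two exponents is again an exponent.\<close>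

lemma finite_add_atoms_rees_exponents: "finite (add_atoms rees_exponents)"
proof (rule ccontr)
  assume inf: "infinite (add_atoms rees_exponents)"
  \<comment> \<open>The subtraction is exact for a cover \<open>D\<close> and an exponent
    \<open>p\<close> of the algebra. It may truncate for other \<open>D\<close>, but only covers are
    used below.\<close>
  define slack where "slack D p = sum (lookup (fst p)) D - snd p"
    for D :: "'v set" and p :: "('v \<Rightarrow>\<^sub>0 nat) \<times> nat"
  let ?F = "range (\<lambda>i p. lookup (fst p) i) \<union> {snd} \<union> range slack"
  have "finite ?F" by simp
  then obtain p q where pq: "p \<in> add_atoms rees_exponents" "q \<in> add_atoms rees_exponents" "p \<noteq> q"
    and le: "\<forall>\<phi>\<in>?F. \<phi> p \<le> \<phi> q"
    using inf by (rule dickson)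
  have M: "p \<in> rees_exponents" "q \<in> rees_exponents" "p \<noteq> 0" using pq by (auto simp: add_atoms_def)
  have le_coord: "lookup (fst p) i \<le> lookup (fst q) i" for i
    using le by auto
  have le_snd: "snd p \<le> snd q" using le by auto
  define d where "d = (fst q - fst p, snd q - snd p)"
  have fst_q: "fst q = fst p + (fst q - fst p)" using le_coord by (rule exponent_eq_add)
  have q: "q = p + d"
    using fst_q le_snd by (simp add: d_def prod_eq_iff)
  have "d \<in> rees_exponents"
  proof -
    have "snd d \<le> sum (lookup (fst d)) D" if D: "vertex_cover C D" for D
    proof -
      have "snd p \<le> sum (lookup (fst p)) D"
        using M(1) D by (auto simp: rees_exponents_def le_cover_weight_iff)
      moreover have "slack D p \<le> slack D q" using le by auto
      moreover have "snd q \<le> sum (lookup (fst q)) D"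
        using M(2) D by (auto simp: rees_exponents_def le_cover_weight_iff)
      ultimately show ?thesis
        by (simp add: slack_def q lookup_add sum.distrib)
    qed
    then show ?thesis by (cases d) (auto simp: rees_exponents_def le_cover_weight_iff)
  qed
  then have "d = 0" using pq(2) M(1,3) q by (auto simp: add_atoms_def)
  then show False using q pq(3) by simp
qed

text \<open>Induction on the total degree in the vertex variables: both parts of a proper splitting
  have smaller degree, since \<open>rees_exponents_fst_zero\<close> forces a positive degree on each
  nonzero exponent.\<close>

lemma add_closure_atoms_rees_exponents: "add_closure (add_atoms rees_exponents) = rees_exponents"
proof
  show "add_closure (add_atoms rees_exponents) \<subseteq> rees_exponents"
  proof
    fix p assume "p \<in> add_closure (add_atoms rees_exponents)"
    then show "p \<in> rees_exponents"
      by induction (auto simp: zero_in_rees_exponents add_atoms_def intro: rees_exponents_add)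
  qed
  show "rees_exponents \<subseteq> add_closure (add_atoms rees_exponents)"
  proof
    fix p assume "p \<in> rees_exponents"
    then show "p \<in> add_closure (add_atoms rees_exponents)"
    proof (induction "sum (lookup (fst p)) UNIV" arbitrary: p rule: less_induct)
      case less
      show ?case
      proof (cases "p = 0 \<or> p \<in> add_atoms rees_exponents")
        case True
        then show ?thesis by (auto intro: add_closure.zero add_closure.base)
      next
        case False
        then obtain q r where qr: "q \<in> rees_exponents" "r \<in> rees_exponents" "p = q + r" "q \<noteq> 0" "r \<noteq> 0"
          using less.prems by (auto simp: add_atoms_def)
        have pos: "0 < sum (lookup (fst s)) UNIV" if "s \<in> rees_exponents" "s \<noteq> 0" for s
        proof (rule ccontr)
          assume "\<not> 0 < sum (lookup (fst s)) UNIV"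
          then have "fst s = 0" by (intro poly_mapping_eqI) simp
          then show False using that rees_exponents_fst_zero[of "snd s"] by (cases s) (auto simp: zero_prod_def)
        qed
        have "sum (lookup (fst p)) UNIV = sum (lookup (fst q)) UNIV + sum (lookup (fst r)) UNIV"
          by (simp add: qr lookup_add sum.distrib)
        then show ?thesis
          using less.hyps[of q] less.hyps[of r] qr pos[of q] pos[of r] by (auto intro: add_closure.add)
      qed
    qed
  qed
qed

lemma minimal_generators_symbolic_rees:
  "minimal_generators (symbolic_rees (edge_ideal C)) =
    (xt ` add_atoms rees_exponents :: ('v, 'k::field) mpoly poly set)"
  unfolding symbolic_rees_edge_ideal
  using finite_add_atoms_rees_exponents add_closure_atoms_rees_exponents
  by (rule minimal_generators_monomial_span)


section \<open>Parallelizations\<close>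

text \<open>An arbitrary finite set \<open>X\<close> of copies handles parallelizations and their
  induced subclutters at once. A cover of \<open>C\<close> lifts to all copies of its vertices; a
  cover \<open>F\<close> of \<open>P\<close> gives the set of vertices whose copies all lie in
  \<open>F\<close>.\<close>

lemma covering_number_copies:
  assumes X: "finite X" and V: "verts P = X"
    and E: "edges P = {(\<lambda>k. (k, j k)) ` e | e j. e \<in> edges C \<and> (\<forall>k\<in>e. (k, j k) \<in> X)}"
  shows "\<alpha>\<^sub>0 P = cover_weight C (\<lambda>i. card {j. (i, j) \<in> X})" (is "_ = cover_weight C ?a")
proof -
  have fin: "finite {j. (i, j) \<in> X}" for i
    using finite_vimageI[OF X, of "Pair i"] by (auto simp: vimage_def inj_on_def)
  have card_copies: "card {p\<in>X. fst p \<in> D} = sum ?a D" for D :: "'v set"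
  proof -
    have "{p\<in>X. fst p \<in> D} = Sigma D (\<lambda>i. {j. (i, j) \<in> X})" by auto
    then show ?thesis using fin by (simp add: card_SigmaI)
  qed
  show ?thesis unfolding covering_number_def
  proof (rule Min_eqI)
    have "{F. vertex_cover P F} \<subseteq> Pow X" using V by (auto simp: vertex_cover_def)
    then show "finite (card ` {F. vertex_cover P F})" using X finite_subset by blast
  next
    fix n assume "n \<in> card ` {F. vertex_cover P F}"
    then obtain F where F: "F \<subseteq> X" "\<forall>e\<in>edges P. e \<inter> F \<noteq> {}" "n = card F"
      using V by (auto simp: vertex_cover_def)
    \<comment> \<open>A vertex without copies belongs to \<open>D\<close> vacuously. It adds nothing
      to the weight, and it covers the edges of \<open>C\<close> that vanish from \<open>P\<close>
      with it.\<close>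
    define D where "D = {i. \<forall>j. (i, j) \<in> X \<longrightarrow> (i, j) \<in> F}"
    have "vertex_cover C D" unfolding vertex_cover_iff
    proof (intro ballI notI)
      fix e assume e: "e \<in> edges C" "e \<inter> D = {}"
      \<comment> \<open>An edge missing \<open>D\<close> has an uncovered copy of each of its
        vertices, and these copies form an edge of \<open>P\<close> missing
        \<open>F\<close>.\<close>
      then have "\<forall>k\<in>e. \<exists>j. (k, j) \<in> X \<and> (k, j) \<notin> F" by (auto simp: D_def)
      then obtain j where j: "\<And>k. k \<in> e \<Longrightarrow> (k, j k) \<in> X \<and> (k, j k) \<notin> F" by metis
      then have "(\<lambda>k. (k, j k)) ` e \<in> edges P" unfolding E using e(1) by blast
      then show False using F(2) j by fastforce
    qed
    then have "cover_weight C ?a \<le> card {p\<in>X. fst p \<in> D}"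
      unfolding card_copies by (rule cover_weight_le)
    also have "\<dots> \<le> n" unfolding F(3)
      using F(1) X by (intro card_mono) (auto simp: D_def intro: finite_subset)
    finally show "cover_weight C ?a \<le> n" .
  next
    obtain D where D: "vertex_cover C D" "cover_weight C ?a = sum ?a D"
      using cover_weight_attained by blast
    have "vertex_cover P {p\<in>X. fst p \<in> D}"
      unfolding vertex_cover_def V
    proof (intro conjI ballI)
      fix e' assume "e' \<in> edges P"
      then obtain e j where e: "e' = (\<lambda>k. (k, j k)) ` e" "e \<in> edges C" "\<forall>k\<in>e. (k, j k) \<in> X"
        unfolding E by blast
      then obtain k where "k \<in> e" "k \<in> D" using D(1) unfolding vertex_cover_iff by blast
      then show "e' \<inter> {p\<in>X. fst p \<in> D} \<noteq> {}" using e by auto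
    qed auto
    then show "cover_weight C ?a \<in> card ` {F. vertex_cover P F}"
      using D(2) card_copies[of D] by (intro image_eqI[of _ _ "{p\<in>X. fst p \<in> D}"]) simp_all
  qed
qed

lemma mem_verts_parallelization: "(i, j) \<in> verts (parallelization C a) \<longleftrightarrow> 1 \<le> j \<and> j \<le> a i"
  by (auto simp: parallelization_def verts)

lemma finite_verts_parallelization: "finite (verts (parallelization C a))"
proof -
  have "verts (parallelization C a) = Sigma UNIV (\<lambda>i. {1..a i})"
    by (auto simp: mem_verts_parallelization)
  then show ?thesis by simp
qed

lemma covering_number_parallelization: "\<alpha>\<^sub>0 (parallelization C a) = cover_weight C a"
proof -
  have "\<alpha>\<^sub>0 (parallelization C a) =
      cover_weight C (\<lambda>i. card {j. (i, j) \<in> verts (parallelization C a)})"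
    by (rule covering_number_copies[OF finite_verts_parallelization refl])
      (auto simp: parallelization_def verts)
  moreover have "{j. (i, j) \<in> verts (parallelization C a)} = {1..a i}" for i
    by (auto simp: mem_verts_parallelization)
  ultimately show ?thesis by simp
qed

lemma covering_number_induced_subclutter:
  assumes "X \<subseteq> verts (parallelization C a)"
  shows "\<alpha>\<^sub>0 (induced_subclutter (parallelization C a) X) =
    cover_weight C (\<lambda>i. card {j. (i, j) \<in> X})"
proof (rule covering_number_copies)
  show "finite X" using assms finite_verts_parallelization finite_subset by blast
  have X: "1 \<le> j \<and> j \<le> a i" if "(i, j) \<in> X" for i j
    using assms that by (auto simp: parallelization_def)
  show "edges (induced_subclutter (parallelization C a) X) =
      {(\<lambda>k. (k, j k)) ` e | e j. e \<in> edges C \<and> (\<forall>k\<in>e. (k, j k) \<in> X)}" (is "?L = ?R")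
  proof (intro subset_antisym subsetI)
    fix e' assume "e' \<in> ?L"
    then obtain e j where "e' = (\<lambda>k. (k, j k)) ` e" "e \<in> edges C" "e' \<subseteq> X"
      unfolding induced_subclutter_def parallelization_def by auto
    then show "e' \<in> ?R" by blast
  next
    fix e' assume "e' \<in> ?R"
    then obtain e j where e: "e' = (\<lambda>k. (k, j k)) ` e" "e \<in> edges C" "\<forall>k\<in>e. (k, j k) \<in> X"
      by blast
    then have "\<forall>k\<in>e. 1 \<le> j k \<and> j k \<le> a k" using X by blast
    then have "e' \<in> edges (parallelization C a)"
      using e(1,2) unfolding parallelization_def by auto
    moreover have "e' \<subseteq> X" using e(1,3) by blast
    ultimately show "e' \<in> ?L" by (simp add: induced_subclutter_def)
  qed
qed (simp add: induced_subclutter_def)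

text \<open>By \<open>covering_number_induced_subclutter\<close> only the number of copies of each
  vertex in a part matters. A partition gives a splitting by counting copies, and any splitting is
  realized by a partition.\<close>

lemma decomposable_parallelization_iff:
  "decomposable (parallelization C a) \<longleftrightarrow>
    (\<exists>a1 a2. a1 \<noteq> (\<lambda>_. 0) \<and> a2 \<noteq> (\<lambda>_. 0) \<and> a = (\<lambda>i. a1 i + a2 i) \<and>
      cover_weight C a = cover_weight C a1 + cover_weight C a2)" (is "_ \<longleftrightarrow> ?R")
proof
  let ?V = "verts (parallelization C a)"
  note V = mem_verts_parallelization[of _ _ a]
  assume "decomposable (parallelization C a)"
  then obtain X1 X2 where X: "X1 \<noteq> {}" "X2 \<noteq> {}" "X1 \<inter> X2 = {}" "?V = X1 \<union> X2"
    and eq: "\<alpha>\<^sub>0 (parallelization C a) = \<alpha>\<^sub>0 (induced_subclutter (parallelization C a) X1)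
      + \<alpha>\<^sub>0 (induced_subclutter (parallelization C a) X2)"
    unfolding decomposable_def by blast
  define count :: "('v \<times> nat) set \<Rightarrow> 'v \<Rightarrow> nat" where "count Y i = card {j. (i, j) \<in> Y}" for Y i
  have fin: "finite {j. (i, j) \<in> Y}" if "Y \<subseteq> ?V" for Y i
    using finite_vimageI[OF finite_subset[OF that finite_verts_parallelization], of "Pair i"]
    by (auto simp: vimage_def inj_on_def)
  have nz: "count Y \<noteq> (\<lambda>_. 0)" if Y: "Y \<noteq> {}" "Y \<subseteq> ?V" for Y
  proof -
    obtain i j where "(i, j) \<in> Y" using Y(1) by auto
    then have "count Y i \<noteq> 0" using fin[OF Y(2), of i] unfolding count_def by (auto simp: card_eq_0_iff)
    then show ?thesis by metis
  qed
  have "a i = count X1 i + count X2 i" for i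
  proof -
    have "a i = card {1..a i}" by simp
    also have "{1..a i} = {j. (i, j) \<in> ?V}" by (auto simp: V)
    also have "\<dots> = {j. (i, j) \<in> X1} \<union> {j. (i, j) \<in> X2}" unfolding X(4) by blast
    also have "card \<dots> = count X1 i + count X2 i"
      unfolding count_def using X(3,4) by (intro card_Un_disjoint fin) auto
    finally show ?thesis .
  qed
  moreover have "cover_weight C a = cover_weight C (count X1) + cover_weight C (count X2)"
    using eq X(4) covering_number_induced_subclutter[of X1 a]
      covering_number_induced_subclutter[of X2 a]
    by (simp add: covering_number_parallelization count_def[abs_def])
  ultimately show ?R using nz[of X1] nz[of X2] X by (intro exI[of _ "count X1"] exI[of _ "count X2"]) (simp add: fun_eq_iff)
next
  let ?V = "verts (parallelization C a)"
  note V = mem_verts_parallelization[of _ _ a]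
  assume ?R
  then obtain a1 a2 where nz: "a1 \<noteq> (\<lambda>_. 0)" "a2 \<noteq> (\<lambda>_. 0)" and a: "\<And>i. a i = a1 i + a2 i"
    and eq: "cover_weight C a = cover_weight C a1 + cover_weight C a2" by auto
  \<comment> \<open>The first \<open>a1 i\<close> copies of \<open>i\<close> go to one part, the
    remaining \<open>a2 i\<close> copies to the other.\<close>
  define X1 X2 where "X1 = {(i, j). 1 \<le> j \<and> j \<le> a1 i}" and "X2 = {(i, j). a1 i < j \<and> j \<le> a i}"
  have sub: "?V = X1 \<union> X2" by (auto simp: V a X1_def X2_def)
  have "{j. (i, j) \<in> X1} = {1..a1 i}" "{j. (i, j) \<in> X2} = {a1 i<..a i}" for i
    by (auto simp: X1_def X2_def)
  then have "\<alpha>\<^sub>0 (induced_subclutter (parallelization C a) X1) = cover_weight C a1"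
    "\<alpha>\<^sub>0 (induced_subclutter (parallelization C a) X2) = cover_weight C a2"
    using covering_number_induced_subclutter[of X1 a] covering_number_induced_subclutter[of X2 a] sub
    by (auto simp: a)
  moreover have "X1 \<noteq> {}"
  proof -
    obtain i where "a1 i \<noteq> 0" using nz by auto
    then have "(i, 1) \<in> X1" by (simp add: X1_def)
    then show ?thesis by auto
  qed
  moreover have "X2 \<noteq> {}"
  proof -
    obtain i where "a2 i \<noteq> 0" using nz by auto
    then have "(i, a i) \<in> X2" by (simp add: X2_def a)
    then show ?thesis by auto
  qed
  moreover have "X1 \<inter> X2 = {}" by (auto simp: X1_def X2_def)
  ultimately show "decomposable (parallelization C a)"
    unfolding decomposable_def using sub eq
    by (intro exI[of _ X1] exI[of _ X2]) (simp add: covering_number_parallelization)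
qed

text \<open>Removing one copy of a vertex lowers the weight of a cover by at most one, so an exponent
  below the covering number splits off a variable.\<close>

lemma add_atom_tight:
  assumes atom: "(m, b) \<in> add_atoms rees_exponents" and m: "m \<noteq> 0"
    and loop: "\<And>i. {i} \<in> edges C \<Longrightarrow> \<not> (m = Poly_Mapping.single i 1 \<and> b = 0)"
  shows "b = cover_weight C (lookup m)"
proof (rule ccontr)
  assume neq: "b \<noteq> cover_weight C (lookup m)"
  have M: "(m, b) \<in> rees_exponents" using atom by (auto simp: add_atoms_def)
  then have less: "b < cover_weight C (lookup m)" using neq by (simp add: rees_exponents_def)
  obtain i where i: "lookup m i \<noteq> 0" using m by (metis lookup_zero poly_mapping_eqI)
  define v where "v = Poly_Mapping.single i (1::nat)"
  have m_eq: "m = v + (m - v)"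
    using i unfolding v_def by (intro exponent_eq_add) (auto simp: lookup_single when_def)
  have "b \<le> sum (lookup (m - v)) D" if "vertex_cover C D" for D
  proof -
    have "sum (lookup v) D \<le> 1" by (simp add: v_def lookup_single when_def)
    moreover have "b < sum (lookup m) D" using less cover_weight_le[OF that] by (rule less_le_trans)
    moreover have "sum (lookup m) D = sum (lookup v) D + sum (lookup (m - v)) D"
      by (subst m_eq) (simp add: lookup_add sum.distrib)
    ultimately show ?thesis by linarith
  qed
  then have "(m - v, b) \<in> rees_exponents" by (simp add: rees_exponents_def le_cover_weight_iff)
  moreover have "(v, 0) \<in> rees_exponents" by (simp add: rees_exponents_def)
  moreover have "(m, b) = (v, 0) + (m - v, b)" using m_eq by simp
  moreover have "(v, 0) \<noteq> 0"
  proof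
    assume "(v, 0) = 0"
    then have "lookup v i = 0" by (simp add: zero_prod_def)
    then show False by (simp add: v_def)
  qed
  \<comment> \<open>An atom splits only trivially, so \<open>m\<close> is the single variable
    \<open>i\<close> and \<open>b\<close> is 0.\<close>
  ultimately have "(m - v, b) = 0" using atom unfolding add_atoms_def by blast
  then have mv: "m = v" and b: "b = 0" using m_eq by (auto simp: zero_prod_def)
  \<comment> \<open>A positive cover weight of a single variable means that all other vertices
    together are no cover, so some edge is contained in \<open>{i}\<close>. This is the case that
    \<open>loop\<close> excludes.\<close>
  have "\<not> vertex_cover C (- {i})"
  proof
    assume "vertex_cover C (- {i})"
    then have "cover_weight C (lookup m) \<le> sum (lookup v) (- {i})"
      unfolding mv by (rule cover_weight_le)
    then show False using less by (simp add: v_def lookup_single when_def)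
  qed
  then obtain e where "e \<in> edges C" "e \<subseteq> {i}" by (auto simp: vertex_cover_iff)
  then have "{i} \<in> edges C" using clutter unfolding clutter_def by (metis subset_singletonD)
  then show False using loop mv b by (auto simp: v_def)
qed

text \<open>A splitting of \<open>lookup m\<close> lifts to exponents by taking the full cover
  weight in each part. Conversely, if \<open>(m, b)\<close> splits, the bounds on both parts and
  superadditivity enclose \<open>b\<close> from both sides, so the weights add up exactly.\<close>

lemma add_atoms_rees_exponents_iff:
  assumes m: "m \<noteq> 0"
    and loop: "\<And>i. {i} \<in> edges C \<Longrightarrow> \<not> (m = Poly_Mapping.single i 1 \<and> b = 0)"
  shows "(m, b) \<in> add_atoms rees_exponents \<longleftrightarrow>
    indecomposable (parallelization C (lookup m)) \<and> b = cover_weight C (lookup m)"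
proof (intro iffI conjI)
  assume atom: "(m, b) \<in> add_atoms rees_exponents"
  show b: "b = cover_weight C (lookup m)" using atom m loop by (rule add_atom_tight)
  show "indecomposable (parallelization C (lookup m))"
  proof
    assume "decomposable (parallelization C (lookup m))"
    then obtain a1 a2 where nz: "a1 \<noteq> (\<lambda>_. 0)" "a2 \<noteq> (\<lambda>_. 0)"
      and a: "lookup m = (\<lambda>i. a1 i + a2 i)"
      and eq: "cover_weight C (lookup m) = cover_weight C a1 + cover_weight C a2"
      unfolding decomposable_parallelization_iff by blast
    let ?p = "\<lambda>a. (Abs_poly_mapping a, cover_weight C a)"
    have "lookup (Abs_poly_mapping a1 + Abs_poly_mapping a2) = lookup m"
      by (simp add: lookup_add_fun a)
    then have "(m, b) = ?p a1 + ?p a2" by (simp add: b eq poly_mapping.lookup_inject)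
    moreover have "?p a1 \<in> rees_exponents" "?p a2 \<in> rees_exponents"
      by (simp_all add: rees_exponents_def)
    moreover have "?p a' \<noteq> 0" if "a' \<noteq> (\<lambda>_. 0)" for a' :: "'v \<Rightarrow> nat"
    proof
      assume "?p a' = 0"
      then have "lookup (Abs_poly_mapping a') = lookup 0" by (simp add: zero_prod_def)
      then show False using that by (simp add: zero_poly_mapping.rep_eq)
    qed
    ultimately show False using atom nz unfolding add_atoms_def by blast
  qed
next
  assume R: "indecomposable (parallelization C (lookup m)) \<and> b = cover_weight C (lookup m)"
  have "q = 0 \<or> r = 0" if qr: "q \<in> rees_exponents" "r \<in> rees_exponents" "(m, b) = q + r" for q r
  proof (rule ccontr)
    assume "\<not> (q = 0 \<or> r = 0)"
    moreover have "lookup (fst s) \<noteq> (\<lambda>_. 0)" if "s \<in> rees_exponents" "s \<noteq> 0" for s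
    proof
      assume "lookup (fst s) = (\<lambda>_. 0)"
      then have "fst s = 0" by (intro poly_mapping_eqI) simp
      then show False
        using that rees_exponents_fst_zero[of "snd s"] by (cases s) (auto simp: zero_prod_def)
    qed
    ultimately have nz: "lookup (fst q) \<noteq> (\<lambda>_. 0)" "lookup (fst r) \<noteq> (\<lambda>_. 0)"
      using qr by auto
    have m_eq: "lookup m = (\<lambda>i. lookup (fst q) i + lookup (fst r) i)" and b: "b = snd q + snd r"
      using qr(3) by (auto simp: prod_eq_iff lookup_add_fun)
    have "snd q \<le> cover_weight C (lookup (fst q))" "snd r \<le> cover_weight C (lookup (fst r))"
      using qr(1,2) by (auto simp: rees_exponents_def)
    then have "cover_weight C (lookup m) =
        cover_weight C (lookup (fst q)) + cover_weight C (lookup (fst r))"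
      using cover_weight_superadditive[of "lookup (fst q)" "lookup (fst r)"] R b m_eq by simp
    then have "decomposable (parallelization C (lookup m))"
      unfolding decomposable_parallelization_iff using nz m_eq by blast
    then show False using R by simp
  qed
  moreover have "(m, b) \<in> rees_exponents" using R by (simp add: rees_exponents_def)
  moreover have "(m, b) \<noteq> 0" using m by (simp add: zero_prod_def)
  ultimately show "(m, b) \<in> add_atoms rees_exponents" unfolding add_atoms_def by blast
qed

end

text \<open>The last assumption removes an exception: if \<open>{i}\<close> is an edge, both
  \<open>x_i\<close> and \<open>x_i t\<close> are minimal generators, whereas the parallelization at
  this exponent has covering number 1, which admits only the second.\<close>

theorem theorem2p6:
  fixes C :: "'v::finite clutter" and a :: "'v \<Rightarrow> nat" and b :: nat
  assumes "clutter C" and "verts C = UNIV"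
    and "a \<noteq> (\<lambda>_. 0)"
    and "\<And>i. {i} \<in> edges C \<Longrightarrow> \<not> (a = (\<lambda>_. 0)(i := 1) \<and> b = 0)"
  shows "xt_monom a b \<in> minimal_generators (symbolic_rees (edge_ideal C :: ('v, 'k::field) mpoly set))
     \<longleftrightarrow> indecomposable (parallelization C a) \<and> b = \<alpha>\<^sub>0 (parallelization C a)"
proof -
  interpret full_clutter C using assms(1,2) by unfold_locales
  define m where "m = Abs_poly_mapping a"
  have a: "lookup m = a" by (simp add: m_def)
  have "m \<noteq> 0" using a assms(3) by (auto simp: zero_poly_mapping.rep_eq)
  moreover have "\<not> (m = Poly_Mapping.single i 1 \<and> b = 0)" if "{i} \<in> edges C" for i
  proof
    assume m: "m = Poly_Mapping.single i 1 \<and> b = 0"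
    then have "a = (\<lambda>_. 0)(i := 1)" by (auto simp: a[symmetric] lookup_single when_def)
    then show False using assms(4)[OF that] m by blast
  qed
  ultimately have "(m, b) \<in> add_atoms rees_exponents \<longleftrightarrow>
      indecomposable (parallelization C a) \<and> b = \<alpha>\<^sub>0 (parallelization C a)"
    using add_atoms_rees_exponents_iff[of m b] by (simp add: a covering_number_parallelization)
  then show ?thesis
    by (simp add: minimal_generators_symbolic_rees xt_monom_eq_xt m_def inj_image_mem_iff[OF inj_xt])
qed

end
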